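(* Let $n \geq 4$ be an integer. Then the connectivity of the graph $Q_n^2$, the square of the hypercube $Q_n$, is maximal, namely it equals its valency: $\kappa(Q_n^2) = n + \binom{n}{2}$.
   Context: All graphs are finite, simple and undirected. The hypercube $Q_n$ is the graph with vertex set $\{0,1\}^n$ in which two $n$-tuples are adjacent if and only if they differ in precisely one coordinate. For a graph $\Gamma=(V,E)$, the square $\Gamma^2$ is the simple graph with vertex set $V$ in which two distinct vertices are adjacent if and only if their distance in $\Gamma$ is at most two. The graph $Q_n^2$ is regular of valency $n+\binom{n}{2}=\binom{n+1}{2}$. A vertex cut of a graph $\Gamma=(V,E)$ is a subset $U$ of $V$ such that the subgraph $\Gamma - U$ induced by $V \setminus U$ is either trivial (a single vertex) or not connected. The connectivity $\kappa(\Gamma)$ of a nontrivial connected graph $\Gamma$ is the minimum cardinality of all vertex cuts of $\Gamma$. One always has $\kappa(\Gamma)\le\delta(\Gamma)$, where $\delta(\Gamma)$ is the minimum degree; "maximal" means that equality holds. *)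

theory Defs
  imports "Graph_Theory.Graph_Theory"
begin

text \<open>
  A finite simple undirected graph is a \<^locale>\<open>pair_graph\<close>: every edge is represented
  by both of its orientations, so the degree of a vertex is its out-degree.
\<close>

definition hypercube :: "nat \<Rightarrow> bool list pair_pre_digraph" where
  "hypercube n = \<lparr> pverts = {x. length x = n},
     parcs = {(x, y). length x = n \<and> length y = n \<and> card {i. i < n \<and> x ! i \<noteq> y ! i} = 1} \<rparr>"

text \<open>
  With unit weights, \<^const>\<open>wf_digraph.\<mu>\<close> is the usual distance
  (infinite between different components).
\<close>

definition graph_dist :: "'a pair_pre_digraph \<Rightarrow> 'a \<Rightarrow> 'a \<Rightarrow> ereal" where
  "graph_dist G u v = wf_digraph.\<mu> (with_proj G) (\<lambda>_. 1) u v"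

definition graph_square :: "'a pair_pre_digraph \<Rightarrow> 'a pair_pre_digraph" where
  "graph_square G = \<lparr> pverts = pverts G,
     parcs = {(u, v). u \<in> pverts G \<and> v \<in> pverts G \<and> u \<noteq> v \<and> graph_dist G u v \<le> 2} \<rparr>"

text \<open>
  The graph without vertices is not connected in the sense of
  \<^const>\<open>Digraph_Component.connected\<close>, so the whole vertex set counts as a vertex cut.
  This does not affect the minimum below: in a nonempty graph, all vertices but one
  form a smaller vertex cut.
\<close>

definition vertex_cut :: "'a pair_pre_digraph \<Rightarrow> 'a set \<Rightarrow> bool" where
  "vertex_cut G U \<longleftrightarrow> U \<subseteq> pverts G \<and>
     (card (pverts G - U) = 1 \<or>
      \<not> Digraph_Component.connected (with_proj G \<restriction> (pverts G - U)))"

definition connectivity :: "'a pair_pre_digraph \<Rightarrow> nat" where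
  "connectivity G = Min (card ` {U. vertex_cut G U})"

definition min_degree :: "'a pair_pre_digraph \<Rightarrow> nat" where
  "min_degree G = Min (out_degree (with_proj G) ` pverts G)"

lemma pair_graphI:
  assumes "finite (pverts G)" "parcs G \<subseteq> pverts G \<times> pverts G" "sym (parcs G)"
    and "\<And>x. (x, x) \<notin> parcs G"
  shows "pair_graph G"
proof -
  have "finite (parcs G)"
    using assms(1,2) by (meson finite_SigmaI finite_subset)
  moreover have "fst e \<in> pverts G" "snd e \<in> pverts G" "fst e \<noteq> snd e" if "e \<in> parcs G" for e
    using that assms(2,4) by (cases e; auto)+
  ultimately show ?thesis
    using assms(1,3) by unfold_locales (simp_all add: symmetric_def)
qed

lemma pair_graph_hypercube: "pair_graph (hypercube n)"
proof (rule pair_graphI)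
  show "finite (pverts (hypercube n))"
    using finite_lists_length_eq[of "UNIV :: bool set" n] by (simp add: hypercube_def)
  show "parcs (hypercube n) \<subseteq> pverts (hypercube n) \<times> pverts (hypercube n)"
    by (auto simp: hypercube_def)
  show "sym (parcs (hypercube n))"
  proof (rule symI)
    fix x y :: "bool list"
    have "{i. i < n \<and> x ! i \<noteq> y ! i} = {i. i < n \<and> y ! i \<noteq> x ! i}"
      by auto
    then show "(y, x) \<in> parcs (hypercube n)" if "(x, y) \<in> parcs (hypercube n)"
      using that unfolding hypercube_def by simp
  qed
  show "(x, x) \<notin> parcs (hypercube n)" for x
    by (simp add: hypercube_def)
qed

lemma graph_dist_commute:
  assumes "pair_graph G"
  shows "graph_dist G u v = graph_dist G v u"
proof -
  interpret pair_graph G by fact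
  have le: "graph_dist G b a \<le> graph_dist G a b" for a b
    unfolding graph_dist_def \<mu>_def
  proof (rule INF_mono)
    fix p assume "p \<in> {p. awalk a p b}"
    then have "awalk a p b" by simp
    then have "\<exists>q. awalk b q a \<and> awalk_cost (\<lambda>_. 1) q = awalk_cost (\<lambda>_. 1) p"
    proof (induction p arbitrary: a)
      case Nil
      then show ?case by (auto simp: awalk_Nil_iff intro!: exI[of _ "[]"])
    next
      case (Cons e p)
      then have e: "e \<in> parcs G" "fst e = a" and w: "awalk (snd e) p b"
        by (auto simp: awalk_Cons_iff)
      obtain q where q: "awalk b q (snd e)"
        "awalk_cost (\<lambda>_. 1) q = awalk_cost (\<lambda>_. 1) p"
        using Cons.IH[OF w] by blast
      have "(snd e, fst e) \<in> parcs G"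
        using e(1) pair_sym_arcs by (cases e) (auto simp: symmetric_def dest: symD)
      then have "awalk (snd e) [(snd e, fst e)] a"
        using e by (auto simp: awalk_def dest: wellformed')
      then have "awalk b (q @ [(snd e, fst e)]) a"
        using q(1) by (auto simp: awalk_append_iff)
      then show ?case using q(2) by (intro exI[of _ "q @ [(snd e, fst e)]"]) auto
    qed
    then obtain q where "awalk b q a" "awalk_cost (\<lambda>_. 1) q = awalk_cost (\<lambda>_. 1) p"
      by blast
    then show "\<exists>q\<in>{q. awalk b q a}. ereal (awalk_cost (\<lambda>_. 1) q) \<le> ereal (awalk_cost (\<lambda>_. 1) p)"
      by auto
  qed
  show ?thesis by (rule antisym[OF le le])
qed

lemma pair_graph_square:
  assumes "pair_graph G"
  shows "pair_graph (graph_square G)"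
proof (rule pair_graphI)
  interpret pair_graph G by fact
  show "finite (pverts (graph_square G))"
    using pair_finite_verts by (simp add: graph_square_def)
  show "parcs (graph_square G) \<subseteq> pverts (graph_square G) \<times> pverts (graph_square G)"
    by (auto simp: graph_square_def)
  show "sym (parcs (graph_square G))"
    using graph_dist_commute[OF assms] by (auto simp: graph_square_def sym_def)
  show "(x, x) \<notin> parcs (graph_square G)" for x
    by (simp add: graph_square_def)
qed

end

theory Submission
  imports Defs
begin

text \<open>
  Put \<open>d n = (n + 1 choose 2)\<close>. Induction on \<open>n\<close> shows that removing a set \<open>S\<close> of fewer than
  \<open>d n\<close> vertices leaves the square of the cube connected. The cube of dimension \<open>n + 1\<close> is the
  union of two halves, in whose square every vertex has \<open>n + 1\<close> neighbours in the opposite half,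
  and \<open>d (n + 1) = d n + (n + 1)\<close>. If \<open>S\<close> takes at most \<open>n\<close> vertices from some half, the rest of
  this half is connected and every remaining vertex of the other half has a neighbour in it.
  Otherwise \<open>S\<close> takes fewer than \<open>d n\<close> vertices from each half, both rests are connected, and
  only one surviving edge between them is needed. For \<open>n \<ge> 4\<close> the perfect matching of the halves
  supplies it since \<open>d (n + 1) \<le> 2 ^ n\<close>; for \<open>n = 3\<close> two surviving vertices of one half
  see at least \<open>6 = d 3\<close> vertices of the other; for \<open>n = 2\<close> the case is void. Conversely, the
  neighbourhood of a vertex is a vertex cut.
\<close>

section \<open>Hamming distance of lists\<close>

definition hamming :: "'a list \<Rightarrow> 'a list \<Rightarrow> nat" where
  "hamming x y = length (filter (\<lambda>(a, b). a \<noteq> b) (zip x y))"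

lemma hamming_simps [simp]:
  "hamming [] y = 0"
  "hamming (a # x) (b # y) = (if a = b then 0 else 1) + hamming x y"
  by (simp_all add: hamming_def)

lemma hamming_eq_card:
  assumes "length x = length y"
  shows "hamming x y = card {i. i < length x \<and> x ! i \<noteq> y ! i}"
  unfolding hamming_def length_filter_conv_card using assms
  by (intro arg_cong[where f = card]) auto

lemma hamming_commute: "length x = length y \<Longrightarrow> hamming x y = hamming y x"
  by (induction x y rule: list_induct2) auto

lemma hamming_le_length: "length x = length y \<Longrightarrow> hamming x y \<le> length x"
  by (induction x y rule: list_induct2) auto

lemma hamming_eq_0_iff [simp]: "length x = length y \<Longrightarrow> hamming x y = 0 \<longleftrightarrow> x = y"
  by (induction x y rule: list_induct2) auto

lemma hamming_self [simp]: "hamming x x = 0"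
  by simp

lemma hamming_triangle:
  "length x = length y \<Longrightarrow> length y = length z \<Longrightarrow> hamming x z \<le> hamming x y + hamming y z"
  by (induction x y z rule: list_induct3) auto

text \<open>Flip the first coordinate in which \<open>x\<close> and \<open>y\<close> differ.
  Iterated, this produces a shortest walk in the hypercube.\<close>

lemma hamming_step:
  "length x = length y \<Longrightarrow> hamming x y = Suc k \<Longrightarrow>
    \<exists>z. length z = length x \<and> hamming x z = 1 \<and> hamming z y = k"
proof (induction x y rule: list_induct2)
  case (Cons a x b y)
  show ?case
  proof (cases "a = b")
    case True
    then obtain z where "length z = length x" "hamming x z = 1" "hamming z y = k"
      using Cons by auto
    then show ?thesis
      using True by (intro exI[of _ "a # z"]) auto
  next
    case False
    then show ?thesis
      using Cons by (intro exI[of _ "b # x"]) auto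
  qed
qed simp

section \<open>Counting in the cube: spheres, balls and a binomial estimate\<close>

definition cube :: "nat \<Rightarrow> bool list set" where
  "cube n = {x. length x = n}"

lemma finite_cube [simp]: "finite (cube n)"
  using finite_lists_length_eq[of "UNIV :: bool set" n] by (simp add: cube_def)

lemma card_cube: "card (cube n) = 2 ^ n"
  using card_lists_length_eq[of "UNIV :: bool set" n] by (simp add: cube_def)

text \<open>Splitting the sphere by the first coordinate of \<open>y\<close> reproduces Pascal's
  rule.\<close>

lemma card_sphere: "x \<in> cube n \<Longrightarrow> card {y \<in> cube n. hamming x y = k} = n choose k"
proof (induction x arbitrary: n k)
  case Nil
  then have "{y \<in> cube n. hamming [] y = k} = (if k = 0 then {[]} else {})"
    by (auto simp: cube_def)
  then show ?case
    using Nil by (auto simp: cube_def)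
next
  case (Cons a x)
  then obtain m where n: "n = Suc m" and x: "x \<in> cube m"
    by (auto simp: cube_def)
  have split: "{y \<in> cube n. hamming (a # x) y = k} =
      (#) a ` {y \<in> cube m. hamming x y = k} \<union> (#) (\<not> a) ` {y \<in> cube m. Suc (hamming x y) = k}"
    (is "_ = (#) _ ` ?A \<union> (#) _ ` ?B")
  proof (intro equalityI subsetI)
    fix y assume "y \<in> {y \<in> cube n. hamming (a # x) y = k}"
    then show "y \<in> (#) a ` ?A \<union> (#) (\<not> a) ` ?B"
      by (cases y) (auto simp: n cube_def split: if_splits)
  qed (auto simp: n cube_def)
  have "card {y \<in> cube n. hamming (a # x) y = k} = card ?A + card ?B"
    unfolding split by (subst card_Un_disjoint) (auto simp: card_image)
  also have "\<dots> = n choose k"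
    using Cons.IH[OF x] by (cases k) (simp_all add: n)
  finally show ?case .
qed

text \<open>This counts the neighbours of a vertex in the opposite half of the next cube: crossing
  over costs 1 of the allowed distance 2, so the remaining coordinates may differ in at most one
  place.\<close>

lemma card_unit_ball:
  assumes "x \<in> cube n"
  shows "card {y \<in> cube n. hamming x y \<le> 1} = Suc n"
proof -
  have "{y \<in> cube n. hamming x y \<le> 1} =
      {y \<in> cube n. hamming x y = 0} \<union> {y \<in> cube n. hamming x y = 1}"
    by auto
  moreover have "card \<dots> =
      card {y \<in> cube n. hamming x y = 0} + card {y \<in> cube n. hamming x y = 1}"
    by (rule card_Un_disjoint) auto
  ultimately show ?thesis
    using card_sphere[OF assms, of 0] card_sphere[OF assms, of 1] by simp
qed

lemma card_square_neighbours:
  assumes "x \<in> cube n"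
  shows "card {y \<in> cube n. x \<noteq> y \<and> hamming x y \<le> 2} = n + (n choose 2)"
proof -
  have "{y \<in> cube n. x \<noteq> y \<and> hamming x y \<le> 2} =
      {y \<in> cube n. hamming x y = 1} \<union> {y \<in> cube n. hamming x y = 2}"
    using assms by (auto simp: cube_def) (metis One_nat_def hamming_eq_0_iff le_0_eq le_SucE numeral_2_eq_2)
  moreover have "card \<dots> =
      card {y \<in> cube n. hamming x y = 1} + card {y \<in> cube n. hamming x y = 2}"
    by (rule card_Un_disjoint) auto
  ultimately show ?thesis
    using card_sphere[OF assms, of 1] card_sphere[OF assms, of 2] by simp
qed

text \<open>Two distinct balls of 4 points share at most 2 points. All pairs of centres are checked
  by evaluation.\<close>

lemma card_two_unit_balls_cube_3:
  assumes "x \<in> cube 3" "y \<in> cube 3" "x \<noteq> y"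
  shows "6 \<le> card {z \<in> cube 3. hamming x z \<le> 1 \<or> hamming y z \<le> 1}"
proof -
  have cube: "cube 3 = set (List.n_lists 3 [True, False])"
    by (auto simp: cube_def set_n_lists)
  have "\<forall>x \<in> set (List.n_lists 3 [True, False]). \<forall>y \<in> set (List.n_lists 3 [True, False]).
      x \<noteq> y \<longrightarrow>
      6 \<le> length (filter (\<lambda>z. hamming x z \<le> 1 \<or> hamming y z \<le> 1) (List.n_lists 3 [True, False]))"
    by code_simp
  then have "6 \<le> length (filter (\<lambda>z. hamming x z \<le> 1 \<or> hamming y z \<le> 1)
      (List.n_lists 3 [True, False]))"
    using assms unfolding cube by blast
  also have "\<dots> = card (set (filter (\<lambda>z. hamming x z \<le> 1 \<or> hamming y z \<le> 1)
      (List.n_lists 3 [True, False])))"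
    by (rule distinct_card[symmetric]) (simp add: distinct_n_lists)
  finally show ?thesis
    by (simp add: cube)
qed

text \<open>The induction starts from 15 \<le> 16; for \<open>n = 3\<close> the bound would read 10
  \<le> 8. Each step adds \<open>Suc (Suc n)\<close>, which is at most the binomial itself, so the
  left side at most doubles.\<close>

lemma Suc_choose_2_le_power:
  assumes "4 \<le> n"
  shows "Suc (Suc n) choose 2 \<le> 2 ^ n"
  using assms
proof (induction rule: dec_induct)
  case base
  show ?case by (simp add: numeral_eq_Suc)
next
  case (step n)
  have "Suc (Suc n) \<le> Suc (Suc n) choose 2"
    using step.hyps by (simp add: numeral_2_eq_2)
  then show ?case
    using step.IH by (simp add: numeral_2_eq_2)
qed

section \<open>Connectedness of the squared cube after few deletions\<close>

definition close :: "bool list rel" where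
  "close = {(x, y). length x = length y \<and> hamming x y \<le> 2}"

lemma sym_close: "sym close"
  by (auto simp: close_def hamming_commute intro: symI)

lemma ex_mem_not_mem_if_card_less: "finite B \<Longrightarrow> card B < card A \<Longrightarrow> \<exists>x\<in>A. x \<notin> B"
  by (meson card_mono linorder_not_le subsetI)

text \<open>A common first entry leaves Hamming distances unchanged, and \<open>close\<close> does
  not mention the dimension, so a walk in a half is also a walk in the whole cube.\<close>

lemma rtrancl_on_close_Cons:
  assumes "(x, y) \<in> rtrancl_on F close" and "\<And>z. z \<in> F \<Longrightarrow> a # z \<in> G"
  shows "(a # x, a # y) \<in> rtrancl_on G close"
  using assms(1)
proof (induction rule: rtrancl_on_induct)
  case (step y z)
  have "(a # y, a # z) \<in> close"
    using step.hyps by (auto simp: close_def)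
  then show ?case
    using step assms(2) by (blast intro: rtrancl_on.intros)
qed (auto intro: assms(2))

lemma square_cube_minus_connected:
  assumes "S \<subseteq> cube n" "card S < Suc n choose 2" "u \<in> cube n - S" "v \<in> cube n - S"
  shows "(u, v) \<in> rtrancl_on (cube n - S) close"
  using assms
proof (induction n arbitrary: S u v)
  \<comment> \<open>Void, since \<open>Suc 0 choose 2 = 0\<close>.\<close>
  case 0
  then show ?case by (simp add: numeral_2_eq_2)
next
  case (Suc n)
  define R where "R = rtrancl_on (cube (Suc n) - S) close"
  have R_sym: "(y, x) \<in> R" if "(x, y) \<in> R" for x y
    using that rtrancl_on_sym[OF sym_close] unfolding R_def by (blast dest: symD)
  have R_trans: "(x, z) \<in> R" if "(x, y) \<in> R" "(y, z) \<in> R" for x y z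
    using that unfolding R_def by (rule rtrancl_on_trans)
  have R_edge: "(x, y) \<in> R" if "(x, y) \<in> close" "x \<in> cube (Suc n) - S" "y \<in> cube (Suc n) - S" for x y
    using that unfolding R_def by (blast intro: rtrancl_on.intros)
  show ?case
  proof (cases "n \<le> 1")
    case True
    \<comment> \<open>In dimension at most 2, any two vertices are within distance 2.\<close>
    then have "(u, v) \<in> close"
      using hamming_le_length[of u v] Suc.prems by (auto simp: close_def cube_def)
    then show ?thesis
      using R_edge Suc.prems unfolding R_def by blast
  next
    case n: False
    \<comment> \<open>The trace of \<open>S\<close> on the half with first entry \<open>a\<close>,
      with that entry dropped so that the induction hypothesis applies to it.\<close>
    define T where "T a = {x. a # x \<in> S}" for a
    have T_sub: "T a \<subseteq> cube n" for a
      using Suc.prems(1) by (auto simp: T_def cube_def)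
    have finite_T [simp]: "finite (T a)" for a
      using T_sub finite_cube finite_subset by blast
    have S_split: "S = (#) a ` T a \<union> (#) (\<not> a) ` T (\<not> a)" for a
    proof (intro equalityI subsetI)
      fix x assume "x \<in> S"
      moreover then obtain b y where "x = b # y"
        using Suc.prems(1) by (cases x) (auto simp: cube_def)
      ultimately show "x \<in> (#) a ` T a \<union> (#) (\<not> a) ` T (\<not> a)"
        by (cases "b = a") (auto simp: T_def)
    qed (auto simp: T_def)
    have card_S: "card S = card (T a) + card (T (\<not> a))" for a
      by (subst S_split[of a], subst card_Un_disjoint) (auto simp: card_image)
    \<comment> \<open>Pascal's rule for \<open>Suc (Suc n) choose 2\<close>.\<close>
    have card_lt: "card (T a) + card (T (\<not> a)) < (Suc n choose 2) + Suc n" for a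
      using Suc.prems(2) unfolding card_S[of a] by (simp add: numeral_2_eq_2)
    have mem: "a # x \<in> cube (Suc n) - S" if "x \<in> cube n - T a" for a x
      using that by (auto simp: T_def cube_def)
    have half: "(a # x, a # y) \<in> R"
      if "card (T a) < Suc n choose 2" "x \<in> cube n - T a" "y \<in> cube n - T a" for a x y
      unfolding R_def using Suc.IH[OF T_sub that] mem by (rule rtrancl_on_close_Cons)
    have cross: "(a # x, (\<not> a) # y) \<in> R"
      if "x \<in> cube n - T a" "y \<in> cube n - T (\<not> a)" "hamming x y \<le> 1" for a x y
      using that mem[of x a] mem[of y "\<not> a"] by (intro R_edge) (auto simp: close_def cube_def)
    \<comment> \<open>One connected half acts as a hub: \<open>u\<close> and \<open>v\<close> each
      reach it, and they are joined inside it.\<close>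
    have via_half: "(u, v) \<in> R"
      if a: "card (T a) < Suc n choose 2"
        and other: "\<And>y. y \<in> cube n - T (\<not> a) \<Longrightarrow> \<exists>x\<in>cube n - T a. (a # x, (\<not> a) # y) \<in> R" for a
    proof -
      have "\<exists>x\<in>cube n - T a. (a # x, w) \<in> R" if w: "w \<in> cube (Suc n) - S" for w
      proof -
        obtain b y where w_eq: "w = b # y"
          using w by (cases w) (auto simp: cube_def)
        then have y: "y \<in> cube n - T b"
          using w by (auto simp: T_def cube_def)
        show ?thesis
        proof (cases "b = a")
          case True
          then show ?thesis
            using y half[OF a] w_eq by blast
        next
          case False
          then have "b = (\<not> a)" by blast
          then show ?thesis
            using other y w_eq by blast
        qed
      qed
      then obtain x x' where "x \<in> cube n - T a" "(a # x, u) \<in> R" "x' \<in> cube n - T a" "(a # x', v) \<in> R"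
        using Suc.prems by blast
      then show ?thesis
        using half[OF a] R_sym R_trans by blast
    qed
    have "(u, v) \<in> R"
    proof (cases "\<exists>a. card (T a) \<le> n")
      case True
      then obtain a where a: "card (T a) \<le> n" ..
      have "Suc n choose 2 = n + (n choose 2)"
        by (simp add: numeral_2_eq_2)
      moreover have "n choose 2 > 0"
        using n by (simp add: zero_less_binomial)
      ultimately have "card (T a) < Suc n choose 2"
        using a by linarith
      then show ?thesis
      proof (rule via_half)
        fix y assume y: "y \<in> cube n - T (\<not> a)"
        \<comment> \<open>The \<open>n + 1\<close> candidate neighbours of \<open>y\<close> in half
          \<open>a\<close> outnumber the at most \<open>n\<close> deletions there.\<close>
        have "card (T a) < card {x \<in> cube n. hamming y x \<le> 1}"
          using card_unit_ball[of y n] y a by simp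
        then obtain x where "x \<in> cube n - T a" "hamming y x \<le> 1"
          using ex_mem_not_mem_if_card_less[OF finite_T] by blast
        then show "\<exists>x\<in>cube n - T a. (a # x, (\<not> a) # y) \<in> R"
          using cross[of x a y] y hamming_commute[of x y] by (auto simp: cube_def)
      qed
    next
      case False
      then have ge: "Suc n \<le> card (T a)" for a
        by (metis not_less_eq_eq)
      \<comment> \<open>The other half absorbs at least \<open>Suc n\<close> of the
        deletions.\<close>
      then have lt: "card (T a) < Suc n choose 2" for a
        using card_lt[of a] ge[of "\<not> a"] by linarith
      have n3: "n \<ge> 3"
      proof (rule ccontr)
        assume "\<not> n \<ge> 3"
        then have "n = 2" using n by simp
        \<comment> \<open>Here both bounds are 3: \<open>3 \<le> card (T True) < 3\<close>.\<close>
        then show False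
          using lt[of True] ge[of True] by (simp add: numeral_2_eq_2)
      qed
      have "\<exists>x \<in> cube n - T True. \<exists>y \<in> cube n - T False. hamming x y \<le> 1"
      proof (cases "n = 3")
        case True
        have d: "Suc n choose 2 = 6"
          using True by (simp add: numeral_eq_Suc)
        \<comment> \<open>At most 5 of the 8 vertices of this half are deleted.\<close>
        have "card (cube n - T True) \<ge> 2"
          using lt[of True] card_Diff_subset[OF finite_T T_sub, of True] d True
          by (simp add: card_cube)
        then obtain x y where xy: "x \<in> cube n - T True" "y \<in> cube n - T True" "x \<noteq> y"
          by (metis card_le_Suc0_iff_eq finite_Diff finite_cube not_less_eq_eq numeral_2_eq_2)
        have "card (T False) < card {z \<in> cube n. hamming x z \<le> 1 \<or> hamming y z \<le> 1}"
          using card_two_unit_balls_cube_3[of x y] xy True lt[of False] d by simp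
        then show ?thesis
          using ex_mem_not_mem_if_card_less[OF finite_T] xy by blast
      next
        case False
        \<comment> \<open>Some \<open>x\<close> outside both traces is wanted: both of its copies
          survive, and they are adjacent.\<close>
        have "card (T True \<union> T False) \<le> card S"
          using card_Un_le[of "T True" "T False"] card_S[of True] by simp
        also have "\<dots> < card (cube n)"
          using Suc_choose_2_le_power[of n] Suc.prems(2) n3 False by (simp add: card_cube)
        finally obtain x where "x \<in> cube n - T True" "x \<in> cube n - T False"
          using ex_mem_not_mem_if_card_less[of "T True \<union> T False" "cube n"] by auto
        then show ?thesis
          by (intro bexI[of _ x]) auto
      qed
      then obtain x y where xy: "x \<in> cube n - T True" "y \<in> cube n - T False" "hamming x y \<le> 1"
        by blast
      \<comment> \<open>The single crossing edge suffices: \<open>y'\<close> is joined to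
        \<open>y\<close> within its own half, and from there to \<open>x\<close>.\<close>
      have "\<exists>x\<in>cube n - T True. (True # x, (\<not> True) # y') \<in> R" if "y' \<in> cube n - T (\<not> True)" for y'
      proof (rule bexI)
        have "(True # x, False # y) \<in> R"
          using cross[of x True y] xy by simp
        moreover have "(False # y, False # y') \<in> R"
          using half[OF lt, of y False y'] that xy by simp
        ultimately show "(True # x, (\<not> True) # y') \<in> R"
          using R_trans by simp
      qed (rule xy)
      then show ?thesis
        by (rule via_half[OF lt])
    qed
    then show ?thesis
      unfolding R_def .
  qed
qed

section \<open>Distances, degrees and vertex cuts in the graphs themselves\<close>

lemma parcs_hypercube:
  "parcs (hypercube n) = {(x, y). x \<in> cube n \<and> y \<in> cube n \<and> hamming x y = 1}"
  by (auto simp: hypercube_def cube_def hamming_eq_card)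

lemma pverts_hypercube: "pverts (hypercube n) = cube n"
  by (simp add: hypercube_def cube_def)

text \<open>By the triangle inequality each arc lowers the Hamming distance to \<open>v\<close> by
  at most 1, which bounds every walk from below; walks built with \<open>hamming_step\<close> attain
  the bound.\<close>

lemma graph_dist_hypercube:
  assumes "u \<in> cube n" "v \<in> cube n"
  shows "graph_dist (hypercube n) u v = hamming u v"
proof -
  interpret pair_graph "hypercube n" by (rule pair_graph_hypercube)
  have lower: "hamming u v \<le> length p" if "awalk u p v" for p
    using that assms(1)
  proof (induction p arbitrary: u)
    case Nil
    then show ?case by (auto simp: awalk_Nil_iff)
  next
    case (Cons e p)
    then have e: "(u, snd e) \<in> parcs (hypercube n)" and w: "awalk (snd e) p v"
      by (auto simp: awalk_Cons_iff)
    have "hamming u v \<le> hamming u (snd e) + hamming (snd e) v"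
      using e assms(2) by (intro hamming_triangle) (auto simp: parcs_hypercube cube_def)
    then show ?case
      using Cons.IH[OF w] e by (auto simp: parcs_hypercube)
  qed
  have upper: "\<exists>p. awalk u p v \<and> length p = hamming u v"
    using assms(1)
  proof (induction "hamming u v" arbitrary: u)
    case 0
    then have "u = v"
      using assms(2) by (simp add: cube_def)
    then show ?case
      using assms(2) by (intro exI[of _ "[]"]) (simp add: awalk_Nil_iff pverts_hypercube)
  next
    case (Suc k)
    then obtain z where z: "z \<in> cube n" "hamming u z = 1" "hamming z v = k"
      using hamming_step[of u v k] assms(2) by (auto simp: cube_def)
    then obtain p where "awalk z p v" "length p = k"
      using Suc.hyps(1) by blast
    then show ?case
      using z Suc.hyps(2) Suc.prems
      by (intro exI[of _ "(u, z) # p"]) (simp add: awalk_Cons_iff parcs_hypercube)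
  qed
  have cost: "awalk_cost (\<lambda>_. 1) p = length p" for p :: "(bool list \<times> bool list) awalk"
    by (induction p) auto
  show ?thesis
    unfolding graph_dist_def \<mu>_def
  proof (rule antisym)
    obtain p where "awalk u p v" "length p = hamming u v"
      using upper by blast
    then show "(INF p\<in>{p. awalk u p v}. ereal (awalk_cost (\<lambda>_. 1) p)) \<le> ereal (hamming u v)"
      by (intro INF_lower2[of p]) (simp_all add: cost)
  qed (auto intro!: INF_greatest simp: cost lower)
qed

lemma pverts_square: "pverts (graph_square (hypercube n)) = cube n"
  by (simp add: graph_square_def pverts_hypercube)

lemma parcs_square:
  "parcs (graph_square (hypercube n)) =
    {(x, y). x \<in> cube n \<and> y \<in> cube n \<and> x \<noteq> y \<and> hamming x y \<le> 2}"
proof -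
  have "ereal (real k) \<le> 2 \<longleftrightarrow> k \<le> 2" for k :: nat
    by (metis ereal_less_eq(3) numeral_eq_ereal of_nat_le_iff of_nat_numeral)
  then show ?thesis
    by (auto simp: graph_square_def pverts_hypercube graph_dist_hypercube)
qed

lemma out_degree_square:
  assumes "x \<in> cube n"
  shows "out_degree (with_proj (graph_square (hypercube n))) x = n + (n choose 2)"
proof -
  have "out_arcs (with_proj (graph_square (hypercube n))) x =
      Pair x ` {y \<in> cube n. x \<noteq> y \<and> hamming x y \<le> 2}"
    using assms by (auto simp: out_arcs_def parcs_square)
  then show ?thesis
    using card_square_neighbours[OF assms]
    by (simp add: out_degree_def card_image inj_on_def)
qed

text \<open>Deleting all neighbours isolates \<open>x\<close>: either \<open>x\<close> alone is
  left, or the rest is disconnected. These are the two alternatives in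
  \<open>vertex_cut\<close>.\<close>

lemma vertex_cut_square_neighbours:
  assumes "x \<in> cube n"
  shows "vertex_cut (graph_square (hypercube n)) {y \<in> cube n. x \<noteq> y \<and> hamming x y \<le> 2}"
    (is "vertex_cut ?G ?U")
proof -
  define H where "H = with_proj ?G \<restriction> (cube n - ?U)"
  have x: "x \<in> cube n - ?U"
    using assms by simp
  have "cube n - ?U = {x}" if "connected H"
  proof (rule ccontr)
    assume "cube n - ?U \<noteq> {x}"
    then obtain y where y: "y \<in> cube n - ?U" "y \<noteq> x"
      using x by blast
    have "(x, y) \<in> rtrancl_on (cube n - ?U) ((arcs_ends H)\<^sup>s)"
      using that x y unfolding connected_conv by (simp add: H_def)
    \<comment> \<open>A walk from \<open>x\<close> to another vertex must start with an edge at
      \<open>x\<close>, but all neighbours of \<open>x\<close> are deleted.\<close>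
    then obtain z where "(x, z) \<in> (arcs_ends H)\<^sup>s"
      using y(2) by (cases rule: converse_rtrancl_on_cases) auto
    then show False
      by (auto simp: H_def symcl_def arcs_ends_conv parcs_square cube_def hamming_commute)
  qed
  then have "card (cube n - ?U) = 1 \<or> \<not> connected H"
    by (metis card_1_singleton_iff One_nat_def)
  moreover have "?U \<subseteq> cube n"
    by blast
  ultimately show ?thesis
    unfolding vertex_cut_def pverts_square H_def by blast
qed

lemma vertex_cut_square_card:
  assumes "vertex_cut (graph_square (hypercube n)) U"
  shows "n + (n choose 2) \<le> card U"
proof (rule ccontr)
  let ?G = "graph_square (hypercube n)"
  assume "\<not> n + (n choose 2) \<le> card U"
  then have less: "card U < Suc n choose 2" "card U < n + (n choose 2)"
    by (simp_all add: numeral_2_eq_2)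
  have U: "U \<subseteq> cube n"
    using assms by (simp add: vertex_cut_def pverts_square)
  obtain x where x: "x \<in> cube n"
    using Ex_list_of_length by (auto simp: cube_def)
  \<comment> \<open>The cube contains \<open>x\<close> besides its neighbours, so at least two
    vertices survive the deletion of \<open>U\<close>. This excludes the single-vertex alternative
    of \<open>vertex_cut\<close>.\<close>
  have "card {y \<in> cube n. x \<noteq> y \<and> hamming x y \<le> 2} < card (cube n)"
    using x by (intro psubset_card_mono) auto
  then have "n + (n choose 2) < card (cube n)"
    by (simp add: card_square_neighbours[OF x])
  then have card: "card (cube n - U) > 1"
    using less U by (simp add: card_Diff_subset finite_subset[OF U])
  have "connected (with_proj ?G \<restriction> (cube n - U))"
    unfolding connected_conv
  proof (intro conjI ballI)
    show "verts (with_proj ?G \<restriction> (cube n - U)) \<noteq> {}"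
      using card by (metis card.empty induce_subgraph_verts not_less_zero)
  next
    fix u v assume uv: "u \<in> verts (with_proj ?G \<restriction> (cube n - U))"
      "v \<in> verts (with_proj ?G \<restriction> (cube n - U))"
    then have "(u, v) \<in> rtrancl_on (cube n - U) close"
      using square_cube_minus_connected[OF U less(1)] by simp
    then have "(u, v) \<in> rtrancl_on (cube n - U) ((arcs_ends (with_proj ?G \<restriction> (cube n - U)))\<^sup>s)"
    proof (induction rule: rtrancl_on_induct)
      case (step y z)
      \<comment> \<open>\<open>close\<close> is reflexive whereas the graph has no loops, so
        stationary steps are treated apart.\<close>
      have "y = z \<or> (y, z) \<in> (arcs_ends (with_proj ?G \<restriction> (cube n - U)))\<^sup>s"
        using step.hyps
        by (force simp: symcl_def arcs_ends_conv parcs_square close_def)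
      then show ?case
        using step by (blast intro: rtrancl_on.intros)
    qed auto
    then show "(u, v) \<in> rtrancl_on (verts (with_proj ?G \<restriction> (cube n - U)))
        ((arcs_ends (with_proj ?G \<restriction> (cube n - U)))\<^sup>s)"
      by simp
  qed
  then show False
    using assms card by (simp add: vertex_cut_def pverts_square)
qed

theorem corollary3p4:
  fixes n :: nat
  assumes "n \<ge> 4"
  shows "connectivity (graph_square (hypercube n)) = min_degree (graph_square (hypercube n)) \<and>
         connectivity (graph_square (hypercube n)) = n + (n choose 2)"
proof -
  let ?G = "graph_square (hypercube n)"
  have x: "replicate n False \<in> cube n"
    by (simp add: cube_def)
  have "out_degree (with_proj ?G) ` cube n = {n + (n choose 2)}"
    using x by (auto simp: out_degree_square)
  then have degree: "min_degree ?G = n + (n choose 2)"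
    by (simp add: min_degree_def pverts_square)
  have "connectivity ?G = n + (n choose 2)"
    unfolding connectivity_def
  proof (rule Min_eqI)
    have "{U. vertex_cut ?G U} \<subseteq> Pow (cube n)"
      by (auto simp: vertex_cut_def pverts_square)
    then show "finite (card ` {U. vertex_cut ?G U})"
      by (meson finite_Pow_iff finite_cube finite_imageI finite_subset)
    show "n + (n choose 2) \<in> card ` {U. vertex_cut ?G U}"
      using vertex_cut_square_neighbours[OF x] card_square_neighbours[OF x]
      by (intro image_eqI[of _ _ "{y \<in> cube n. replicate n False \<noteq> y \<and> hamming (replicate n False) y \<le> 2}"]) simp_all
  qed (auto dest: vertex_cut_square_card)
  then show ?thesis
    using degree by simp
qed

end
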